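(* Assume $H_0s_0+h_0=0$. Then the maps $$x_i=T_iz_i+t_i\ (i=0,\ldots,N),\qquad u_i=Y_iz_i+Z_iv_i+y_i\ (i=0,\ldots,N-1)$$ give a bijection between trajectories $(z_0,\ldots,z_N,v_0,\ldots,v_{N-1})$ of the reduced LQR problem and feasible trajectories $(x_0,\ldots,x_N,u_0,\ldots,u_{N-1})$ of the original equality-constrained LQR problem. Corresponding objective values differ by the constant $\sum_{i=0}^N\kappa_i$ (the original objective value equals the reduced objective value plus $\sum_{i=0}^N\kappa_i$). Hence corresponding minimizers coincide: a trajectory of the reduced problem is a minimizer of the reduced problem if and only if its image is a minimizer of the original problem.
   Context: Original problem: a horizon $N\ge1$, state dimensions $n_0,\ldots,n_N$, control dimensions $m_0,\ldots,m_{N-1}$ (possibly varying by stage), real data of compatible sizes with $Q_i$ and $R_i$ symmetric (no definiteness assumed), $s_0\in\mathbb R^{n_0}$, and $$\begin{aligned}\min_{x,u}\ &\sum_{i=0}^{N-1}\ell_i(x_i,u_i)+\tfrac12x_N^{\top}Q_Nx_N+q_N^{\top}x_N\\ \text{s.t. }&x_0=s_0,\\ &x_{i+1}=A_ix_i+B_iu_i+c_i,\quad C_ix_i+D_iu_i+d_i=0\quad(i=0,\ldots,N-1),\\ &E_ix_i+e_i=0\quad(i=0,\ldots,N),\end{aligned}$$ where $\ell_i(x,u)=\tfrac12x^{\top}Q_ix+x^{\top}M_iu+\tfrac12u^{\top}R_iu+q_i^{\top}x+r_i^{\top}u$. Empty matrices represent absent constraints; no rank assumptions are made on the constraints. Suffix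 domains: $\mathcal X_i\subseteq\mathbb R^{n_i}$ is the set of $x_i$ from which there exist controls $u_i,\ldots,u_{N-1}$ and states $x_{i+1},\ldots,x_N$ satisfying the dynamics, the mixed constraints and the state constraints at stages $i,\ldots,N-1$ and the terminal constraint $E_Nx_N+e_N=0$ (the initial condition is not imposed). It is an affine set represented as $\mathcal X_i=\{x_i:H_ix_i+h_i=0\}$ for some chosen $H_i,h_i$. The condition $H_0s_0+h_0=0$ means $s_0\in\mathcal X_0$ and implies that all $\mathcal X_i$ are nonempty. Choose $t_i$ with $H_it_i+h_i=0$, $T_i\in\mathbb R^{n_i\times\bar n_i}$ whose columns form a basis of the null space of $H_i$, and any left inverse $S_i$ of $T_i$ ($S_iT_i=I_{\bar n_i}$). Then $\mathcal X_i=\{T_iz_i+t_i:z_i\in\mathbb R^{\bar n_i}\}$. Controls: for $i=0,\ldots,N-1$ let $$\Gamma_i=\begin{bmatrix}D_i\\H_{i+1}B_i\end{bmatrix},\quad \Phi_i=\begin{bmatrix}C_iT_i\\H_{i+1}A_iT_i\end{bmatrix},\quad \gamma_i=\begin{bmatrix}C_it_i+d_i\\H_{i+1}(A_it_i+c_i)+h_{i+1}\end{bmatrix}.$$ Choose $Y_i,Z_i,y_i$ such that the columns of $Z_i\in\mathbb R^{m_i\times\bar m_i}$ form a basis of the null space of $\Gamma_i$ and, for every $z_i$, the solution set of $\Gamma_iu_i+\Phi_iz_i+\gamma_i=0$ is exactly $\{Y_iz_i+Z_iv_i+y_i:v_i\in\mathbb R^{\bar m_i}\}$ (such a choice always exists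 here). Reduced data: $$\bar A_i=S_{i+1}(A_iT_i+B_iY_i),\quad \bar B_i=S_{i+1}B_iZ_i,\quad \bar c_i=S_{i+1}(A_it_i+B_iy_i+c_i-t_{i+1}),$$ $$Q_i^z=T_i^{\top}Q_iT_i,\quad M_i^z=T_i^{\top}M_i,\quad q_i^z=T_i^{\top}(Q_it_i+q_i),\quad r_i^z=M_i^{\top}t_i+r_i,$$ $$\bar Q_i=Q_i^z+M_i^zY_i+Y_i^{\top}(M_i^z)^{\top}+Y_i^{\top}R_iY_i,\quad \bar M_i=M_i^zZ_i+Y_i^{\top}R_iZ_i,\quad \bar R_i=Z_i^{\top}R_iZ_i,$$ $$\bar q_i=q_i^z+M_i^zy_i+Y_i^{\top}(R_iy_i+r_i^z),\quad \bar r_i=Z_i^{\top}(R_iy_i+r_i^z)$$ for $i=0,\ldots,N-1$, and $\bar Q_N=T_N^{\top}Q_NT_N$, $\bar q_N=T_N^{\top}(Q_Nt_N+q_N)$. The constants are $\kappa_i=\tfrac12t_i^{\top}Q_it_i+q_i^{\top}t_i+\tfrac12y_i^{\top}R_iy_i+(r_i^z)^{\top}y_i$ for $i<N$ and $\kappa_N=\tfrac12t_N^{\top}Q_Nt_N+q_N^{\top}t_N$. Reduced LQR problem: minimize $$\sum_{i=0}^{N-1}\Big(\tfrac12z_i^{\top}\bar Q_iz_i+z_i^{\top}\bar M_iv_i+\tfrac12v_i^{\top}\bar R_iv_i+\bar q_i^{\top}z_i+\bar r_i^{\top}v_i\Big)+\tfrac12z_N^{\top}\bar Q_Nz_N+\bar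 q_N^{\top}z_N$$ over $z_i\in\mathbb R^{\bar n_i}$, $v_i\in\mathbb R^{\bar m_i}$ subject only to $z_0=S_0(s_0-t_0)$ and $z_{i+1}=\bar A_iz_i+\bar B_iv_i+\bar c_i$ for $i=0,\ldots,N-1$. A trajectory of the reduced problem is a tuple $(z,v)$ satisfying these two conditions. *)

theory Defs
  imports "Jordan_Normal_Form.Matrix_Kernel" "HOL-Library.FuncSet"
begin

section \<open>LQR problems with stage-dependent dimensions\<close>

text \<open>
  Data are indexed by stage. Only the entries with index below the horizon \<open>N\<close>
  (and additionally index \<open>N\<close> for \<open>xdim\<close>, \<open>costQ\<close>, \<open>costq\<close> and the state constraints)
  have a meaning. Dimensions may be zero; absent constraints are matrices with zero rows.
\<close>

record lqr =
  horizon :: nat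
  xdim :: "nat \<Rightarrow> nat"
  udim :: "nat \<Rightarrow> nat"
  init :: "real vec"
  dynA :: "nat \<Rightarrow> real mat"
  dynB :: "nat \<Rightarrow> real mat"
  dync :: "nat \<Rightarrow> real vec"
  costQ :: "nat \<Rightarrow> real mat"
  costM :: "nat \<Rightarrow> real mat"
  costR :: "nat \<Rightarrow> real mat"
  costq :: "nat \<Rightarrow> real vec"
  costr :: "nat \<Rightarrow> real vec"

record eq_lqr = lqr +
  mixdim :: "nat \<Rightarrow> nat"
  mixC :: "nat \<Rightarrow> real mat"
  mixD :: "nat \<Rightarrow> real mat"
  mixd :: "nat \<Rightarrow> real vec"
  stdim :: "nat \<Rightarrow> nat"
  stE :: "nat \<Rightarrow> real mat"
  ste :: "nat \<Rightarrow> real vec"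

definition wf_lqr :: "'a lqr_scheme \<Rightarrow> bool" where
  "wf_lqr L \<longleftrightarrow>
     horizon L \<ge> 1 \<and>
     init L \<in> carrier_vec (xdim L 0) \<and>
     (\<forall>i<horizon L.
        dynA L i \<in> carrier_mat (xdim L (Suc i)) (xdim L i) \<and>
        dynB L i \<in> carrier_mat (xdim L (Suc i)) (udim L i) \<and>
        dync L i \<in> carrier_vec (xdim L (Suc i)) \<and>
        costM L i \<in> carrier_mat (xdim L i) (udim L i) \<and>
        costR L i \<in> carrier_mat (udim L i) (udim L i) \<and>
        (costR L i)\<^sup>T = costR L i \<and>
        costr L i \<in> carrier_vec (udim L i)) \<and>
     (\<forall>i\<le>horizon L.
        costQ L i \<in> carrier_mat (xdim L i) (xdim L i) \<and>
        (costQ L i)\<^sup>T = costQ L i \<and>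
        costq L i \<in> carrier_vec (xdim L i))"

definition wf_eq_lqr :: "'a eq_lqr_scheme \<Rightarrow> bool" where
  "wf_eq_lqr P \<longleftrightarrow>
     wf_lqr P \<and>
     (\<forall>i<horizon P.
        mixC P i \<in> carrier_mat (mixdim P i) (xdim P i) \<and>
        mixD P i \<in> carrier_mat (mixdim P i) (udim P i) \<and>
        mixd P i \<in> carrier_vec (mixdim P i)) \<and>
     (\<forall>i\<le>horizon P.
        stE P i \<in> carrier_mat (stdim P i) (xdim P i) \<and>
        ste P i \<in> carrier_vec (stdim P i))"

type_synonym trajectory = "(nat \<Rightarrow> real vec) \<times> (nat \<Rightarrow> real vec)"

definition stage_cost :: "'a lqr_scheme \<Rightarrow> nat \<Rightarrow> real vec \<Rightarrow> real vec \<Rightarrow> real" where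
  "stage_cost L i x u =
     1/2 * (x \<bullet> (costQ L i *\<^sub>v x)) + x \<bullet> (costM L i *\<^sub>v u) + 1/2 * (u \<bullet> (costR L i *\<^sub>v u))
       + costq L i \<bullet> x + costr L i \<bullet> u"

definition objective :: "'a lqr_scheme \<Rightarrow> trajectory \<Rightarrow> real" where
  "objective L = (\<lambda>(x, u).
     (\<Sum>i<horizon L. stage_cost L i (x i) (u i))
       + 1/2 * (x (horizon L) \<bullet> (costQ L (horizon L) *\<^sub>v x (horizon L)))
       + costq L (horizon L) \<bullet> x (horizon L))"

text \<open>
  A tuple \<open>(x\<^sub>0, \<dots>, x\<^sub>N, u\<^sub>0, \<dots>, u\<^sub>N\<^sub>-\<^sub>1)\<close> is a pair of extensional functions, so that
  equality of trajectories is equality of tuples.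
\<close>

definition trajectories :: "'a lqr_scheme \<Rightarrow> trajectory set" where
  "trajectories L = {(x, u).
     x \<in> (\<Pi>\<^sub>E i\<in>{..horizon L}. carrier_vec (xdim L i)) \<and>
     u \<in> (\<Pi>\<^sub>E i\<in>{..<horizon L}. carrier_vec (udim L i)) \<and>
     x 0 = init L \<and>
     (\<forall>i<horizon L. x (Suc i) = dynA L i *\<^sub>v x i + dynB L i *\<^sub>v u i + dync L i)}"

definition mixed_constraint :: "'a eq_lqr_scheme \<Rightarrow> nat \<Rightarrow> real vec \<Rightarrow> real vec \<Rightarrow> bool" where
  "mixed_constraint P i x u \<longleftrightarrow>
     mixC P i *\<^sub>v x + mixD P i *\<^sub>v u + mixd P i = 0\<^sub>v (mixdim P i)"

definition state_constraint :: "'a eq_lqr_scheme \<Rightarrow> nat \<Rightarrow> real vec \<Rightarrow> bool" where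
  "state_constraint P i x \<longleftrightarrow> stE P i *\<^sub>v x + ste P i = 0\<^sub>v (stdim P i)"

definition feasible_trajectories :: "'a eq_lqr_scheme \<Rightarrow> trajectory set" where
  "feasible_trajectories P = {(x, u) \<in> trajectories P.
     (\<forall>i<horizon P. mixed_constraint P i (x i) (u i)) \<and>
     (\<forall>i\<le>horizon P. state_constraint P i (x i))}"

definition suffix_domain :: "'a eq_lqr_scheme \<Rightarrow> nat \<Rightarrow> real vec set" where
  "suffix_domain P i = {\<xi>. \<exists>x u.
     x i = \<xi> \<and>
     (\<forall>j\<in>{i..horizon P}. x j \<in> carrier_vec (xdim P j) \<and> state_constraint P j (x j)) \<and>
     (\<forall>j\<in>{i..<horizon P}.
        u j \<in> carrier_vec (udim P j) \<and>
        x (Suc j) = dynA P j *\<^sub>v x j + dynB P j *\<^sub>v u j + dync P j \<and>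
        mixed_constraint P j (x j) (u j))}"

section \<open>Reduction to an unconstrained LQR problem\<close>

text \<open>
  The quantities chosen in the reduction. The reduced dimensions are the numbers of columns
  of \<open>parT\<close> and \<open>parZ\<close>.
\<close>

record reduction =
  domH :: "nat \<Rightarrow> real mat"
  domh :: "nat \<Rightarrow> real vec"
  part :: "nat \<Rightarrow> real vec"
  parT :: "nat \<Rightarrow> real mat"
  parS :: "nat \<Rightarrow> real mat"
  parY :: "nat \<Rightarrow> real mat"
  parZ :: "nat \<Rightarrow> real mat"
  pary :: "nat \<Rightarrow> real vec"

definition columns_basis_null_space :: "real mat \<Rightarrow> real mat \<Rightarrow> bool" where
  "columns_basis_null_space T H \<longleftrightarrow>
     T \<in> carrier_mat (dim_col H) (dim_col T) \<and>
     distinct (cols T) \<and> kernel.basis (dim_col H) H (set (cols T))"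

definition represents_suffix_domains :: "'a eq_lqr_scheme \<Rightarrow> 'b reduction_scheme \<Rightarrow> bool" where
  "represents_suffix_domains P \<rho> \<longleftrightarrow>
     (\<forall>i\<le>horizon P.
        domH \<rho> i \<in> carrier_mat (dim_row (domH \<rho> i)) (xdim P i) \<and>
        domh \<rho> i \<in> carrier_vec (dim_row (domH \<rho> i)) \<and>
        suffix_domain P i =
          {x \<in> carrier_vec (xdim P i). domH \<rho> i *\<^sub>v x + domh \<rho> i = 0\<^sub>v (dim_row (domH \<rho> i))})"

definition parametrizes_states :: "'a eq_lqr_scheme \<Rightarrow> 'b reduction_scheme \<Rightarrow> bool" where
  "parametrizes_states P \<rho> \<longleftrightarrow>
     (\<forall>i\<le>horizon P.
        part \<rho> i \<in> carrier_vec (xdim P i) \<and>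
        domH \<rho> i *\<^sub>v part \<rho> i + domh \<rho> i = 0\<^sub>v (dim_row (domH \<rho> i)) \<and>
        columns_basis_null_space (parT \<rho> i) (domH \<rho> i) \<and>
        parS \<rho> i \<in> carrier_mat (dim_col (parT \<rho> i)) (xdim P i) \<and>
        parS \<rho> i * parT \<rho> i = 1\<^sub>m (dim_col (parT \<rho> i)))"

definition ctrl_Gamma :: "'a eq_lqr_scheme \<Rightarrow> 'b reduction_scheme \<Rightarrow> nat \<Rightarrow> real mat" where
  "ctrl_Gamma P \<rho> i = mixD P i @\<^sub>r (domH \<rho> (Suc i) * dynB P i)"

definition ctrl_Phi :: "'a eq_lqr_scheme \<Rightarrow> 'b reduction_scheme \<Rightarrow> nat \<Rightarrow> real mat" where
  "ctrl_Phi P \<rho> i = (mixC P i * parT \<rho> i) @\<^sub>r (domH \<rho> (Suc i) * dynA P i * parT \<rho> i)"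

definition ctrl_gamma :: "'a eq_lqr_scheme \<Rightarrow> 'b reduction_scheme \<Rightarrow> nat \<Rightarrow> real vec" where
  "ctrl_gamma P \<rho> i =
     (mixC P i *\<^sub>v part \<rho> i + mixd P i) @\<^sub>v
     (domH \<rho> (Suc i) *\<^sub>v (dynA P i *\<^sub>v part \<rho> i + dync P i) + domh \<rho> (Suc i))"

definition parametrizes_controls :: "'a eq_lqr_scheme \<Rightarrow> 'b reduction_scheme \<Rightarrow> bool" where
  "parametrizes_controls P \<rho> \<longleftrightarrow>
     (\<forall>i<horizon P.
        parY \<rho> i \<in> carrier_mat (udim P i) (dim_col (parT \<rho> i)) \<and>
        pary \<rho> i \<in> carrier_vec (udim P i) \<and>
        columns_basis_null_space (parZ \<rho> i) (ctrl_Gamma P \<rho> i) \<and>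
        (\<forall>z\<in>carrier_vec (dim_col (parT \<rho> i)).
           {u \<in> carrier_vec (udim P i).
              ctrl_Gamma P \<rho> i *\<^sub>v u + ctrl_Phi P \<rho> i *\<^sub>v z + ctrl_gamma P \<rho> i
                = 0\<^sub>v (dim_row (ctrl_Gamma P \<rho> i))}
           = {parY \<rho> i *\<^sub>v z + parZ \<rho> i *\<^sub>v v + pary \<rho> i | v. v \<in> carrier_vec (dim_col (parZ \<rho> i))}))"

definition Qz :: "'a eq_lqr_scheme \<Rightarrow> 'b reduction_scheme \<Rightarrow> nat \<Rightarrow> real mat" where
  "Qz P \<rho> i = (parT \<rho> i)\<^sup>T * costQ P i * parT \<rho> i"

definition Mz :: "'a eq_lqr_scheme \<Rightarrow> 'b reduction_scheme \<Rightarrow> nat \<Rightarrow> real mat" where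
  "Mz P \<rho> i = (parT \<rho> i)\<^sup>T * costM P i"

definition qz :: "'a eq_lqr_scheme \<Rightarrow> 'b reduction_scheme \<Rightarrow> nat \<Rightarrow> real vec" where
  "qz P \<rho> i = (parT \<rho> i)\<^sup>T *\<^sub>v (costQ P i *\<^sub>v part \<rho> i + costq P i)"

definition rz :: "'a eq_lqr_scheme \<Rightarrow> 'b reduction_scheme \<Rightarrow> nat \<Rightarrow> real vec" where
  "rz P \<rho> i = (costM P i)\<^sup>T *\<^sub>v part \<rho> i + costr P i"

definition reduced_lqr :: "'a eq_lqr_scheme \<Rightarrow> 'b reduction_scheme \<Rightarrow> lqr" where
  "reduced_lqr P \<rho> =
     \<lparr> horizon = horizon P,
       xdim = (\<lambda>i. dim_col (parT \<rho> i)),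
       udim = (\<lambda>i. dim_col (parZ \<rho> i)),
       init = parS \<rho> 0 *\<^sub>v (init P - part \<rho> 0),
       dynA = (\<lambda>i. parS \<rho> (Suc i) * (dynA P i * parT \<rho> i + dynB P i * parY \<rho> i)),
       dynB = (\<lambda>i. parS \<rho> (Suc i) * dynB P i * parZ \<rho> i),
       dync = (\<lambda>i. parS \<rho> (Suc i) *\<^sub>v
                 (dynA P i *\<^sub>v part \<rho> i + dynB P i *\<^sub>v pary \<rho> i + dync P i - part \<rho> (Suc i))),
       costQ = (\<lambda>i. if i < horizon P
                    then Qz P \<rho> i + Mz P \<rho> i * parY \<rho> i + (parY \<rho> i)\<^sup>T * (Mz P \<rho> i)\<^sup>T
                           + (parY \<rho> i)\<^sup>T * costR P i * parY \<rho> i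
                    else Qz P \<rho> i),
       costM = (\<lambda>i. Mz P \<rho> i * parZ \<rho> i + (parY \<rho> i)\<^sup>T * costR P i * parZ \<rho> i),
       costR = (\<lambda>i. (parZ \<rho> i)\<^sup>T * costR P i * parZ \<rho> i),
       costq = (\<lambda>i. if i < horizon P
                    then qz P \<rho> i + Mz P \<rho> i *\<^sub>v pary \<rho> i
                           + (parY \<rho> i)\<^sup>T *\<^sub>v (costR P i *\<^sub>v pary \<rho> i + rz P \<rho> i)
                    else qz P \<rho> i),
       costr = (\<lambda>i. (parZ \<rho> i)\<^sup>T *\<^sub>v (costR P i *\<^sub>v pary \<rho> i + rz P \<rho> i)) \<rparr>"

definition kappa :: "'a eq_lqr_scheme \<Rightarrow> 'b reduction_scheme \<Rightarrow> nat \<Rightarrow> real" where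
  "kappa P \<rho> i =
     1/2 * (part \<rho> i \<bullet> (costQ P i *\<^sub>v part \<rho> i)) + costq P i \<bullet> part \<rho> i
       + (if i < horizon P
          then 1/2 * (pary \<rho> i \<bullet> (costR P i *\<^sub>v pary \<rho> i)) + rz P \<rho> i \<bullet> pary \<rho> i
          else 0)"

definition lift_trajectory ::
    "'a eq_lqr_scheme \<Rightarrow> 'b reduction_scheme \<Rightarrow> trajectory \<Rightarrow> trajectory" where
  "lift_trajectory P \<rho> = (\<lambda>(z, v).
     (\<lambda>i\<in>{..horizon P}. parT \<rho> i *\<^sub>v z i + part \<rho> i,
      \<lambda>i\<in>{..<horizon P}. parY \<rho> i *\<^sub>v z i + parZ \<rho> i *\<^sub>v v i + pary \<rho> i))"

definition minimizer :: "'a lqr_scheme \<Rightarrow> trajectory set \<Rightarrow> trajectory \<Rightarrow> bool" where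
  "minimizer L F \<tau> \<longleftrightarrow> is_arg_min (objective L) (\<lambda>\<tau>'. \<tau>' \<in> F) \<tau>"

end

theory Submission
  imports Defs "Jordan_Normal_Form.DL_Rank"
begin

text \<open>
  For \<open>x = T\<^sub>i z + t\<^sub>i\<close> in \<open>X\<^sub>i\<close>, a control \<open>u\<close> solves \<open>\<Gamma>\<^sub>i u + \<Phi>\<^sub>i z + \<gamma>\<^sub>i = 0\<close> iff it satisfies the mixed
  constraint and steers \<open>x\<close> into \<open>X\<^sub>i\<^sub>+\<^sub>1\<close>. Feasible trajectories stay in the suffix domains, and
  membership in a suffix domain contains the state constraint; so feasibility amounts to the
  solvability of these one-step equations, whose solutions are parametrised bijectively by \<open>v\<close>.
  The left inverse \<open>S\<^sub>i\<^sub>+\<^sub>1\<close> then recovers the coordinate of the successor state, which gives the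
  reduced dynamics. The cost identity is a stagewise bilinear expansion using symmetry of
  \<open>Q\<^sub>i\<close> and \<open>R\<^sub>i\<close>.
\<close>

section \<open>Null-space bases as injective parametrisations\<close>

text \<open>Brings the set-based notion of a basis into matrix form. As the columns are distinct,
  linear combinations over the set of columns are exactly the products \<open>T *\<^sub>v z\<close>.
  The facts are then closure, spanning and linear independence.\<close>

lemma columns_basis_null_spaceD:
  assumes "columns_basis_null_space T H"
  shows "z \<in> carrier_vec (dim_col T) \<Longrightarrow> T *\<^sub>v z \<in> mat_kernel H"
    and "w \<in> mat_kernel H \<Longrightarrow> \<exists>z\<in>carrier_vec (dim_col T). w = T *\<^sub>v z"
    and "\<lbrakk>z \<in> carrier_vec (dim_col T); T *\<^sub>v z = 0\<^sub>v (dim_row T)\<rbrakk> \<Longrightarrow> z = 0\<^sub>v (dim_col T)"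
proof -
  interpret K: kernel "dim_row H" "dim_col H" H
    by unfold_locales auto
  let ?B = "set (cols T)"
  have T: "T \<in> carrier_mat (dim_col H) (dim_col T)" and dist: "distinct (cols T)"
    and basis: "K.basis ?B"
    using assms unfolding columns_basis_null_space_def by auto
  have B: "?B \<subseteq> mat_kernel H" and span: "K.span ?B = mat_kernel H" and indpt: "\<not> K.lin_dep ?B"
    using basis unfolding K.Ker.basis_def by auto
  have BV: "?B \<subseteq> carrier_vec (dim_col H)"
    using T cols_dim by fastforce
  \<comment> \<open>The column set is finite, so its span consists of combinations over the whole
    set. \<open>K.span_same\<close> moves the span from the kernel to the ambient space.\<close>
  have span_eq: "mat_kernel H = {K.NC.lincomb a ?B | a. True}"
    using K.NC.finite_span[of ?B] BV span K.span_same[OF B] by (auto simp: module_vec_simps class_ring_simps)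
  show "T *\<^sub>v z \<in> mat_kernel H" if "z \<in> carrier_vec (dim_col T)"
    using K.NC.lincomb_eq_mat_mult[OF T that dist] span_eq by (metis (mono_tags, lifting) mem_Collect_eq)
  show "\<exists>z\<in>carrier_vec (dim_col T). w = T *\<^sub>v z" if "w \<in> mat_kernel H"
    using that K.NC.mat_mult_eq_lincomb[OF T dist] unfolding span_eq
    by (smt (verit) mem_Collect_eq vec_carrier)
  show "z = 0\<^sub>v (dim_col T)"
    if "z \<in> carrier_vec (dim_col T)" "T *\<^sub>v z = 0\<^sub>v (dim_row T)"
  proof (rule ccontr)
    have "T *\<^sub>v z = 0\<^sub>v (dim_col H)"
      using that(2) carrier_matD(1)[OF T] by simp
    moreover assume "z \<noteq> 0\<^sub>v (dim_col T)"
    ultimately have "K.NC.lin_dep ?B"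
      using K.NC.lin_depI[OF T that(1) _ _ dist] by blast
    then show False
      using indpt K.lindep_same[OF B] by blast
  qed
qed

text \<open>
  Hypotheses on dimensions instead of carriers leave no schematic dimensions in the side
  conditions, so that these rules can be used for rewriting.
\<close>

lemma scalar_prod_add_left_dim:
  fixes x y z :: "'a :: semiring_0 vec"
  assumes "dim_vec x = dim_vec z" "dim_vec y = dim_vec z"
  shows "(x + y) \<bullet> z = x \<bullet> z + y \<bullet> z"
  by (rule add_scalar_prod_distrib[of _ "dim_vec z"]) (use assms in \<open>auto intro: carrier_vecI\<close>)

lemma scalar_prod_add_right_dim:
  fixes x y z :: "'a :: semiring_0 vec"
  assumes "dim_vec y = dim_vec x" "dim_vec z = dim_vec x"
  shows "x \<bullet> (y + z) = x \<bullet> y + x \<bullet> z"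
  by (rule scalar_prod_add_distrib[of _ "dim_vec x"]) (use assms in \<open>auto intro: carrier_vecI\<close>)

lemma mult_mat_vec_add_dim:
  fixes A :: "'a :: semiring_0 mat"
  assumes "dim_vec x = dim_col A" "dim_vec y = dim_col A"
  shows "A *\<^sub>v (x + y) = A *\<^sub>v x + A *\<^sub>v y"
  by (rule mult_add_distrib_mat_vec[of _ "dim_row A" "dim_col A"])
    (use assms in \<open>auto intro: carrier_vecI\<close>)

lemma add_mult_mat_vec_dim:
  fixes A :: "'a :: semiring_0 mat"
  assumes "dim_row A = dim_row B" "dim_col A = dim_col B" "dim_vec x = dim_col B"
  shows "(A + B) *\<^sub>v x = A *\<^sub>v x + B *\<^sub>v x"
  by (rule add_mult_distrib_mat_vec[of _ "dim_row A" "dim_col A"])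
    (use assms in \<open>auto intro: carrier_vecI\<close>)

lemma mult_mat_mult_mat_vec_dim:
  fixes A :: "'a :: semiring_0 mat"
  assumes "dim_col A = dim_row B" "dim_vec x = dim_col B"
  shows "(A * B) *\<^sub>v x = A *\<^sub>v (B *\<^sub>v x)"
  by (rule assoc_mult_mat_vec[of _ "dim_row A" "dim_col A" _ "dim_col B"])
    (use assms in \<open>auto intro: carrier_vecI\<close>)

lemma scalar_prod_transpose_left_dim:
  fixes A :: "'a :: comm_semiring_0 mat"
  assumes "dim_vec x = dim_col A" "dim_vec y = dim_row A"
  shows "(A\<^sup>T *\<^sub>v y) \<bullet> x = y \<bullet> (A *\<^sub>v x)"
  by (rule transpose_vec_mult_scalar[of _ "dim_row A" "dim_col A"])
    (use assms in \<open>auto intro: carrier_vecI\<close>)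

lemma scalar_prod_commute_dim:
  fixes x y :: "'a :: comm_semiring_0 vec"
  assumes "dim_vec x = dim_vec y"
  shows "x \<bullet> y = y \<bullet> x"
  by (rule comm_scalar_prod[of _ "dim_vec x"]) (use assms in \<open>auto intro: carrier_vecI\<close>)

lemma scalar_prod_transpose_right_dim:
  fixes A :: "'a :: comm_semiring_0 mat"
  assumes "dim_vec x = dim_col A" "dim_vec y = dim_row A"
  shows "x \<bullet> (A\<^sup>T *\<^sub>v y) = (A *\<^sub>v x) \<bullet> y"
  using assms scalar_prod_transpose_left_dim[OF assms]
  by (metis dim_mult_mat_vec index_transpose_mat(2) scalar_prod_commute_dim)

lemma scalar_prod_symmetric_mat:
  fixes A :: "'a :: comm_semiring_0 mat"
  assumes "A\<^sup>T = A" "dim_vec x = dim_col A" "dim_vec y = dim_row A"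
  shows "x \<bullet> (A *\<^sub>v y) = y \<bullet> (A *\<^sub>v x)"
  using assms scalar_prod_transpose_left_dim[of x A y] scalar_prod_commute_dim[of x "A *\<^sub>v y"]
  by (metis dim_mult_mat_vec index_transpose_mat(2))

lemmas bilinear_simps = scalar_prod_add_left_dim scalar_prod_add_right_dim
  mult_mat_vec_add_dim add_mult_mat_vec_dim mult_mat_mult_mat_vec_dim
  scalar_prod_transpose_left_dim scalar_prod_transpose_right_dim

section \<open>Setting and stagewise dimensions\<close>

locale lqr_reduction =
  fixes P :: "'a eq_lqr_scheme" and \<rho> :: "'b reduction_scheme"
  assumes wf: "wf_eq_lqr P"
    and suffix_domains: "represents_suffix_domains P \<rho>"
    and init_domain: "domH \<rho> 0 *\<^sub>v init P + domh \<rho> 0 = 0\<^sub>v (dim_row (domH \<rho> 0))"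
    and states: "parametrizes_states P \<rho>"
    and controls: "parametrizes_controls P \<rho>"
begin

abbreviation "N \<equiv> horizon P"
abbreviation "L \<equiv> reduced_lqr P \<rho>"

definition state_of :: "nat \<Rightarrow> real vec \<Rightarrow> real vec" where
  "state_of i z = parT \<rho> i *\<^sub>v z + part \<rho> i"

definition control_of :: "nat \<Rightarrow> real vec \<Rightarrow> real vec \<Rightarrow> real vec" where
  "control_of i z v = parY \<rho> i *\<^sub>v z + parZ \<rho> i *\<^sub>v v + pary \<rho> i"

lemma state_dims [simp]:
  assumes "i \<le> N"
  shows "dim_row (costQ P i) = xdim P i" "dim_col (costQ P i) = xdim P i"
    "dim_vec (costq P i) = xdim P i"
    "dim_row (parT \<rho> i) = xdim P i" "dim_vec (part \<rho> i) = xdim P i"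
    "dim_row (parS \<rho> i) = dim_col (parT \<rho> i)" "dim_col (parS \<rho> i) = xdim P i"
    "dim_col (domH \<rho> i) = xdim P i" "dim_vec (domh \<rho> i) = dim_row (domH \<rho> i)"
  using assms wf states suffix_domains
  unfolding wf_eq_lqr_def wf_lqr_def parametrizes_states_def represents_suffix_domains_def
    columns_basis_null_space_def carrier_mat_def carrier_vec_def
  by auto

lemma control_dims [simp]:
  assumes "i < N"
  shows "dim_row (dynA P i) = xdim P (Suc i)" "dim_col (dynA P i) = xdim P i"
    "dim_row (dynB P i) = xdim P (Suc i)" "dim_col (dynB P i) = udim P i"
    "dim_vec (dync P i) = xdim P (Suc i)"
    "dim_row (costM P i) = xdim P i" "dim_col (costM P i) = udim P i"
    "dim_row (costR P i) = udim P i" "dim_col (costR P i) = udim P i"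
    "dim_vec (costr P i) = udim P i"
    "dim_row (mixC P i) = mixdim P i" "dim_col (mixC P i) = xdim P i"
    "dim_row (mixD P i) = mixdim P i" "dim_col (mixD P i) = udim P i"
    "dim_vec (mixd P i) = mixdim P i"
    "dim_row (parY \<rho> i) = udim P i" "dim_col (parY \<rho> i) = dim_col (parT \<rho> i)"
    "dim_row (parZ \<rho> i) = udim P i" "dim_vec (pary \<rho> i) = udim P i"
  \<comment> \<open>\<open>ctrl_Gamma\<close> is unfolded for the row count of \<open>parZ\<close>:
    it equals the number of columns of the stacked matrix, which is that of
    \<open>mixD\<close>.\<close>
  using assms wf controls
  unfolding wf_eq_lqr_def wf_lqr_def parametrizes_controls_def
    columns_basis_null_space_def ctrl_Gamma_def append_rows_def carrier_mat_def carrier_vec_def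
  by auto

lemma symmetric_cost:
  shows "i \<le> N \<Longrightarrow> (costQ P i)\<^sup>T = costQ P i"
    and "i < N \<Longrightarrow> (costR P i)\<^sup>T = costR P i"
  using wf unfolding wf_eq_lqr_def wf_lqr_def by auto

section \<open>Cost identities\<close>

text \<open>Substitute x = a + t and u = b + c + y with a = Tz, b = Yz, c = Zv, and expand. The
  terms free of z and v form \<open>kappa\<close>; the others are the reduced quadratic and linear
  terms.\<close>

lemma reduced_stage_cost:
  assumes i: "i < N"
    and z: "dim_vec z = dim_col (parT \<rho> i)" and v: "dim_vec v = dim_col (parZ \<rho> i)"
  shows "stage_cost P i (state_of i z) (control_of i z v) = stage_cost L i z v + kappa P \<rho> i"
proof -
  note [simp] = i z v less_imp_le[OF i]
  let ?a = "parT \<rho> i *\<^sub>v z" and ?b = "parY \<rho> i *\<^sub>v z" and ?c = "parZ \<rho> i *\<^sub>v v"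
    and ?t = "part \<rho> i" and ?y = "pary \<rho> i"
  let ?Q = "costQ P i" and ?M = "costM P i" and ?R = "costR P i"
  \<comment> \<open>The expansion produces cross terms in both orders. Symmetry merges each pair,
    cancelling the factor 1/2; \<open>comm\<close> normalises the order left by moving transposes
    across inner products.\<close>
  have sym: "?a \<bullet> (?Q *\<^sub>v ?t) = ?t \<bullet> (?Q *\<^sub>v ?a)" "?c \<bullet> (?R *\<^sub>v ?b) = ?b \<bullet> (?R *\<^sub>v ?c)"
    "?y \<bullet> (?R *\<^sub>v ?b) = ?b \<bullet> (?R *\<^sub>v ?y)" "?y \<bullet> (?R *\<^sub>v ?c) = ?c \<bullet> (?R *\<^sub>v ?y)"
    using symmetric_cost i by (intro scalar_prod_symmetric_mat; simp)+
  have comm: "(?Q *\<^sub>v ?t) \<bullet> ?a = ?a \<bullet> (?Q *\<^sub>v ?t)" 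
    "(?M *\<^sub>v ?b) \<bullet> ?a = ?a \<bullet> (?M *\<^sub>v ?b)" "(?M *\<^sub>v ?c) \<bullet> ?a = ?a \<bullet> (?M *\<^sub>v ?c)" "(?M *\<^sub>v ?y) \<bullet> ?a = ?a \<bullet> (?M *\<^sub>v ?y)" 
    "(?R *\<^sub>v ?y) \<bullet> ?b = ?b \<bullet> (?R *\<^sub>v ?y)" "(?R *\<^sub>v ?y) \<bullet> ?c = ?c \<bullet> (?R *\<^sub>v ?y)"
    by (intro scalar_prod_commute_dim; simp)+
  show ?thesis
    by (simp add: stage_cost_def kappa_def reduced_lqr_def Qz_def Mz_def qz_def rz_def
        state_of_def control_of_def bilinear_simps)
      (simp add: sym comm add_divide_distrib)
qed

lemma reduced_terminal_cost:
  assumes z: "dim_vec z = dim_col (parT \<rho> N)"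
  shows "1/2 * (state_of N z \<bullet> (costQ P N *\<^sub>v state_of N z)) + costq P N \<bullet> state_of N z
    = 1/2 * (z \<bullet> (costQ L N *\<^sub>v z)) + costq L N \<bullet> z + kappa P \<rho> N"
proof -
  note [simp] = z
  let ?a = "parT \<rho> N *\<^sub>v z" and ?t = "part \<rho> N" and ?Q = "costQ P N"
  have sym: "?a \<bullet> (?Q *\<^sub>v ?t) = ?t \<bullet> (?Q *\<^sub>v ?a)"
    using symmetric_cost by (intro scalar_prod_symmetric_mat) simp_all
  have comm: "(?Q *\<^sub>v ?t) \<bullet> ?a = ?a \<bullet> (?Q *\<^sub>v ?t)"
    by (intro scalar_prod_commute_dim) simp
  show ?thesis
    \<comment> \<open>At stage N the case distinctions in \<open>reduced_lqr\<close> and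
      \<open>kappa\<close> take their control-free branches.\<close>
    by (simp add: kappa_def reduced_lqr_def Qz_def qz_def state_of_def bilinear_simps)
      (simp add: sym comm)
qed

section \<open>Affine coordinates on the suffix domains\<close>

lemma suffix_domain_eq:
  assumes "i \<le> N"
  shows "suffix_domain P i =
    {x \<in> carrier_vec (xdim P i). domH \<rho> i *\<^sub>v x + domh \<rho> i = 0\<^sub>v (dim_row (domH \<rho> i))}"
  using suffix_domains assms unfolding represents_suffix_domains_def by blast

lemma dim_state_of [simp]: "i \<le> N \<Longrightarrow> dim_vec (state_of i z) = xdim P i"
  by (simp add: state_of_def)

lemma dim_control_of [simp]: "i < N \<Longrightarrow> dim_vec (control_of i z v) = udim P i"
  by (simp add: control_of_def)

lemma state_param:
  assumes "i \<le> N"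
  shows "domH \<rho> i *\<^sub>v part \<rho> i + domh \<rho> i = 0\<^sub>v (dim_row (domH \<rho> i))"
    and "columns_basis_null_space (parT \<rho> i) (domH \<rho> i)"
    and "parS \<rho> i * parT \<rho> i = 1\<^sub>m (dim_col (parT \<rho> i))"
  using states assms unfolding parametrizes_states_def by blast+

text \<open>Subtracting t leaves Tz, and ST = I. Later this also gives injectivity of
  \<open>state_of\<close>.\<close>

lemma state_of_inverse:
  assumes i: "i \<le> N" and z: "z \<in> carrier_vec (dim_col (parT \<rho> i))"
  shows "parS \<rho> i *\<^sub>v (state_of i z - part \<rho> i) = z"
proof -
  have "state_of i z - part \<rho> i = parT \<rho> i *\<^sub>v z"
    using i by (auto simp: state_of_def)
  then show ?thesis
    using mult_mat_mult_mat_vec_dim[of "parS \<rho> i" "parT \<rho> i" z] state_param(3)[OF i] i z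
    by simp
qed

lemma state_of_in_suffix_domain:
  assumes i: "i \<le> N" and z: "z \<in> carrier_vec (dim_col (parT \<rho> i))"
  shows "state_of i z \<in> suffix_domain P i"
proof -
  have "domH \<rho> i *\<^sub>v (parT \<rho> i *\<^sub>v z) = 0\<^sub>v (dim_row (domH \<rho> i))"
    using columns_basis_null_spaceD(1)[OF state_param(2)[OF i] z] by (simp add: mat_kernel_def)
  then have "domH \<rho> i *\<^sub>v state_of i z + domh \<rho> i = domH \<rho> i *\<^sub>v part \<rho> i + domh \<rho> i"
    using i by (auto simp: state_of_def mult_mat_vec_add_dim)
  then show ?thesis
    using i state_param(1)[OF i] by (auto simp: suffix_domain_eq intro: carrier_vecI)
qed

text \<open>Two solutions of Hx + h = 0 differ by a kernel vector, hence by some Tz. On the column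
  space of T every left inverse S recovers z, so the choice of S does not matter.\<close>

lemma suffix_domain_state_of:
  assumes i: "i \<le> N" and x: "x \<in> suffix_domain P i"
  shows "state_of i (parS \<rho> i *\<^sub>v (x - part \<rho> i)) = x"
proof -
  let ?H = "domH \<rho> i"
  have dim: "dim_vec x = xdim P i" and zero: "?H *\<^sub>v x + domh \<rho> i = 0\<^sub>v (dim_row ?H)"
    using x i by (auto simp: suffix_domain_eq)
  define w where "w = x - part \<rho> i"
  have w: "dim_vec w = xdim P i" and xw: "x = w + part \<rho> i"
    using i dim by (auto simp: w_def)
  have "?H *\<^sub>v w = (?H *\<^sub>v x + domh \<rho> i) - (?H *\<^sub>v part \<rho> i + domh \<rho> i)"
    unfolding xw using i w by (subst mult_mat_vec_add_dim) auto
  then have "w \<in> mat_kernel ?H"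
    using zero state_param(1)[OF i] i w by (auto simp: mat_kernel_def intro: carrier_vecI)
  then obtain z where z: "z \<in> carrier_vec (dim_col (parT \<rho> i))" "w = parT \<rho> i *\<^sub>v z"
    using columns_basis_null_spaceD(2)[OF state_param(2)[OF i]] by blast
  then have "x = state_of i z"
    by (simp add: xw state_of_def)
  then show ?thesis
    using state_of_inverse[OF i z(1)] by simp
qed

text \<open>This is how lifted trajectories obtain their state constraints, since \<open>stE\<close>
  does not occur in the control equation.\<close>

lemma suffix_domain_state_constraint:
  "x \<in> suffix_domain P i \<Longrightarrow> i \<le> N \<Longrightarrow> state_constraint P i x"
  unfolding suffix_domain_def by auto

section \<open>The one-step control equation\<close>

definition step :: "nat \<Rightarrow> real vec \<Rightarrow> real vec \<Rightarrow> real vec" where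
  "step i x u = dynA P i *\<^sub>v x + dynB P i *\<^sub>v u + dync P i"

lemma dim_step [simp]: "i < N \<Longrightarrow> dim_vec (step i x u) = xdim P (Suc i)"
  by (simp add: step_def)

text \<open>The upper block row is the mixed constraint at x = Tz + t; the lower one is the equation
  of the next suffix domain at the successor state.\<close>

lemma control_equation_iff:
  assumes i: "i < N"
    and z: "z \<in> carrier_vec (dim_col (parT \<rho> i))" and u: "u \<in> carrier_vec (udim P i)"
  shows "ctrl_Gamma P \<rho> i *\<^sub>v u + ctrl_Phi P \<rho> i *\<^sub>v z + ctrl_gamma P \<rho> i
      = 0\<^sub>v (dim_row (ctrl_Gamma P \<rho> i))
    \<longleftrightarrow> mixed_constraint P i (state_of i z) u \<and> step i (state_of i z) u \<in> suffix_domain P (Suc i)"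
proof -
  note [simp] = i less_imp_le[OF i] Suc_leI[OF i]
  let ?H = "domH \<rho> (Suc i)" and ?m = "mixdim P i"
  let ?k = "dim_row ?H"
  let ?x = "parT \<rho> i *\<^sub>v z" and ?t = "part \<rho> i"
  have zu [simp]: "dim_vec z = dim_col (parT \<rho> i)" "dim_vec u = udim P i"
    using z u by auto
  have Gamma: "ctrl_Gamma P \<rho> i *\<^sub>v u = (mixD P i *\<^sub>v u) @\<^sub>v (?H *\<^sub>v (dynB P i *\<^sub>v u))"
    unfolding ctrl_Gamma_def
    by (subst mat_mult_append[of _ ?m "udim P i" _ ?k])
      (auto simp: mult_mat_mult_mat_vec_dim intro: carrier_matI carrier_vecI)
  have Phi: "ctrl_Phi P \<rho> i *\<^sub>v z = (mixC P i *\<^sub>v ?x) @\<^sub>v (?H *\<^sub>v (dynA P i *\<^sub>v ?x))"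
    unfolding ctrl_Phi_def
    by (subst mat_mult_append[of _ ?m "dim_col (parT \<rho> i)" _ ?k])
      (auto simp: mult_mat_mult_mat_vec_dim intro: carrier_matI carrier_vecI)
  \<comment> \<open>The two blocks, grouped into control, coordinate and constant parts as the three
    summands deliver them; \<open>p\<close> and \<open>q\<close> below regroup them by
    state.\<close>
  let ?p = "mixD P i *\<^sub>v u + mixC P i *\<^sub>v ?x + (mixC P i *\<^sub>v ?t + mixd P i)"
  let ?q = "?H *\<^sub>v (dynB P i *\<^sub>v u) + ?H *\<^sub>v (dynA P i *\<^sub>v ?x)
    + (?H *\<^sub>v (dynA P i *\<^sub>v ?t + dync P i) + domh \<rho> (Suc i))"
  have sum: "ctrl_Gamma P \<rho> i *\<^sub>v u + ctrl_Phi P \<rho> i *\<^sub>v z + ctrl_gamma P \<rho> i = ?p @\<^sub>v ?q"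
    unfolding Gamma Phi ctrl_gamma_def
    by (simp add: append_vec_add[of _ ?m _ _ ?k] carrier_vecI)
  have rows: "0\<^sub>v (dim_row (ctrl_Gamma P \<rho> i)) = 0\<^sub>v ?m @\<^sub>v 0\<^sub>v ?k"
    by (auto simp: ctrl_Gamma_def append_rows_def)
  have p: "?p = mixC P i *\<^sub>v state_of i z + mixD P i *\<^sub>v u + mixd P i"
    by (auto simp: state_of_def mult_mat_vec_add_dim)
  have q: "?q = ?H *\<^sub>v step i (state_of i z) u + domh \<rho> (Suc i)"
    by (auto simp: state_of_def step_def mult_mat_vec_add_dim)
  show ?thesis
    unfolding sum rows
    by (subst append_vec_eq[of _ ?m])
      (auto simp: p q mixed_constraint_def suffix_domain_eq intro: carrier_vecI)
qed

text \<open>Combines the defining property of Y, Z, y with the block equation. One direction makes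
  every v an admissible step; the other supplies v for an admissible control.\<close>

lemma control_of_iff:
  assumes i: "i < N"
    and z: "z \<in> carrier_vec (dim_col (parT \<rho> i))" and u: "u \<in> carrier_vec (udim P i)"
  shows "mixed_constraint P i (state_of i z) u \<and> step i (state_of i z) u \<in> suffix_domain P (Suc i)
    \<longleftrightarrow> (\<exists>v\<in>carrier_vec (dim_col (parZ \<rho> i)). u = control_of i z v)"
proof -
  have "{u \<in> carrier_vec (udim P i). ctrl_Gamma P \<rho> i *\<^sub>v u + ctrl_Phi P \<rho> i *\<^sub>v z + ctrl_gamma P \<rho> i
        = 0\<^sub>v (dim_row (ctrl_Gamma P \<rho> i))}
      = {control_of i z v | v. v \<in> carrier_vec (dim_col (parZ \<rho> i))}"
    using controls i z unfolding parametrizes_controls_def control_of_def by blast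
  then show ?thesis
    using control_equation_iff[OF i z u] u by blast
qed

text \<open>For fixed z the parts Yz and y cancel, and Z is injective because its columns are
  linearly independent.\<close>

lemma control_of_inject:
  assumes i: "i < N" and v: "v \<in> carrier_vec (dim_col (parZ \<rho> i))"
    and w: "w \<in> carrier_vec (dim_col (parZ \<rho> i))"
    and eq: "control_of i z v = control_of i z w"
  shows "v = w"
proof -
  have "columns_basis_null_space (parZ \<rho> i) (ctrl_Gamma P \<rho> i)"
    using controls i unfolding parametrizes_controls_def by blast
  note inj = columns_basis_null_spaceD(3)[OF this]
  have "parZ \<rho> i *\<^sub>v v = parZ \<rho> i *\<^sub>v w"
  proof (rule eq_vecI)
    fix k assume k: "k < dim_vec (parZ \<rho> i *\<^sub>v w)"
    have "control_of i z v $ k = control_of i z w $ k"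
      using eq by simp
    then show "(parZ \<rho> i *\<^sub>v v) $ k = (parZ \<rho> i *\<^sub>v w) $ k"
      using i k by (simp add: control_of_def)
  qed simp
  then have "parZ \<rho> i *\<^sub>v (v - w) = 0\<^sub>v (dim_row (parZ \<rho> i))"
    using v w by (subst mult_minus_distrib_mat_vec[of _ "dim_row (parZ \<rho> i)"]) auto
  then have diff: "v - w = 0\<^sub>v (dim_col (parZ \<rho> i))"
    using inj v w by simp
  show ?thesis
  proof (rule eq_vecI)
    fix k assume "k < dim_vec w"
    then show "v $ k = w $ k"
      using arg_cong[OF diff, of "\<lambda>x. x $ k"] w by simp
  qed (use v w in simp)
qed

section \<open>Reduced dynamics\<close>

text \<open>A linearity identity: the reduced dynamics perform the original step and read off the
  coordinate of the result relative to the next base point.\<close>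

lemma reduced_step:
  assumes i: "i < N"
    and z: "z \<in> carrier_vec (dim_col (parT \<rho> i))" and v: "v \<in> carrier_vec (dim_col (parZ \<rho> i))"
  shows "dynA L i *\<^sub>v z + dynB L i *\<^sub>v v + dync L i
    = parS \<rho> (Suc i) *\<^sub>v (step i (state_of i z) (control_of i z v) - part \<rho> (Suc i))"
proof -
  note [simp] = i less_imp_le[OF i] Suc_leI[OF i]
  have [simp]: "dim_vec z = dim_col (parT \<rho> i)" "dim_vec v = dim_col (parZ \<rho> i)"
    using z v by auto
  let ?S = "parS \<rho> (Suc i)" and ?A = "dynA P i" and ?B = "dynB P i"
  \<comment> \<open>The summands are grouped to match the reduced A, B and c before the left inverse
    is applied.\<close>
  have split: "step i (state_of i z) (control_of i z v) - part \<rho> (Suc i)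
    = (?A *\<^sub>v (parT \<rho> i *\<^sub>v z) + ?B *\<^sub>v (parY \<rho> i *\<^sub>v z)) + ?B *\<^sub>v (parZ \<rho> i *\<^sub>v v)
      + (?A *\<^sub>v part \<rho> i + ?B *\<^sub>v pary \<rho> i + dync P i - part \<rho> (Suc i))"
    by (auto simp: step_def state_of_def control_of_def mult_mat_vec_add_dim)
  show ?thesis
    unfolding split
    by (simp add: reduced_lqr_def mult_mat_vec_add_dim add_mult_mat_vec_dim mult_mat_mult_mat_vec_dim)
qed

lemma trajectories_reduced_iff:
  "(z, v) \<in> trajectories L \<longleftrightarrow>
    z \<in> (\<Pi>\<^sub>E i\<in>{..N}. carrier_vec (dim_col (parT \<rho> i))) \<and>
    v \<in> (\<Pi>\<^sub>E i\<in>{..<N}. carrier_vec (dim_col (parZ \<rho> i))) \<and>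
    z 0 = parS \<rho> 0 *\<^sub>v (init P - part \<rho> 0) \<and>
    (\<forall>i<N. z (Suc i) =
      parS \<rho> (Suc i) *\<^sub>v (step i (state_of i (z i)) (control_of i (z i) (v i)) - part \<rho> (Suc i)))"
  (is "?lhs \<longleftrightarrow> ?rhs")
proof -
  have "?lhs \<longleftrightarrow>
    z \<in> (\<Pi>\<^sub>E i\<in>{..N}. carrier_vec (dim_col (parT \<rho> i))) \<and>
    v \<in> (\<Pi>\<^sub>E i\<in>{..<N}. carrier_vec (dim_col (parZ \<rho> i))) \<and>
    z 0 = parS \<rho> 0 *\<^sub>v (init P - part \<rho> 0) \<and>
    (\<forall>i<N. z (Suc i) = dynA L i *\<^sub>v z i + dynB L i *\<^sub>v v i + dync L i)"
    by (simp add: trajectories_def reduced_lqr_def)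
  also have "\<dots> \<longleftrightarrow> ?rhs"
    by (intro conj_cong refl all_cong) (subst reduced_step; auto)
  finally show ?thesis .
qed

lemma init_in_suffix_domain: "init P \<in> suffix_domain P 0"
  using wf init_domain by (auto simp: suffix_domain_eq wf_eq_lqr_def wf_lqr_def)

lemma lift_trajectory_apply:
  "lift_trajectory P \<rho> (z, v) =
    (\<lambda>i\<in>{..N}. state_of i (z i), \<lambda>i\<in>{..<N}. control_of i (z i) (v i))"
  by (simp add: lift_trajectory_def state_of_def control_of_def)

lemma reduced_trajectoryD:
  assumes "(z, v) \<in> trajectories L"
  shows "i \<le> N \<Longrightarrow> z i \<in> carrier_vec (dim_col (parT \<rho> i))"
    and "i < N \<Longrightarrow> v i \<in> carrier_vec (dim_col (parZ \<rho> i))"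
    and "state_of 0 (z 0) = init P"
    and "i < N \<Longrightarrow> state_of (Suc i) (z (Suc i)) = step i (state_of i (z i)) (control_of i (z i) (v i))"
    and "i < N \<Longrightarrow> mixed_constraint P i (state_of i (z i)) (control_of i (z i) (v i))"
proof -
  have z: "z i \<in> carrier_vec (dim_col (parT \<rho> i))" if "i \<le> N" for i
    using that assms by (auto simp: trajectories_reduced_iff)
  have v: "v i \<in> carrier_vec (dim_col (parZ \<rho> i))" if "i < N" for i
    using that assms by (auto simp: trajectories_reduced_iff)
  show "i \<le> N \<Longrightarrow> z i \<in> carrier_vec (dim_col (parT \<rho> i))"
    and "i < N \<Longrightarrow> v i \<in> carrier_vec (dim_col (parZ \<rho> i))"
    by (fact z v)+
  show "state_of 0 (z 0) = init P"
    using assms suffix_domain_state_of[OF _ init_in_suffix_domain]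
    by (simp add: trajectories_reduced_iff)
  assume i: "i < N"
  have *: "mixed_constraint P i (state_of i (z i)) (control_of i (z i) (v i)) \<and>
      step i (state_of i (z i)) (control_of i (z i) (v i)) \<in> suffix_domain P (Suc i)"
    using control_of_iff[OF i z[OF less_imp_le[OF i]]] v[OF i] dim_control_of[OF i]
    by (metis carrier_vecI)
  then show "mixed_constraint P i (state_of i (z i)) (control_of i (z i) (v i))"
    by blast
  show "state_of (Suc i) (z (Suc i)) = step i (state_of i (z i)) (control_of i (z i) (v i))"
    using assms i suffix_domain_state_of[OF Suc_leI[OF i] conjunct2[OF *]]
    by (simp add: trajectories_reduced_iff)
qed

section \<open>Bijection of trajectories\<close>

text \<open>The tail of the trajectory is itself the required witness.\<close>

lemma feasible_in_suffix_domain: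
  assumes "(x, u) \<in> feasible_trajectories P" and "i \<le> N"
  shows "x i \<in> suffix_domain P i"
  unfolding suffix_domain_def
  by (intro CollectI exI[of _ x] exI[of _ u])
    (use assms in \<open>auto simp: feasible_trajectories_def trajectories_def\<close>)

lemma lift_feasible:
  assumes zv: "(z, v) \<in> trajectories L"
  shows "lift_trajectory P \<rho> (z, v) \<in> feasible_trajectories P"
proof -
  note D = reduced_trajectoryD[OF zv]
  have "state_constraint P i (state_of i (z i))" if "i \<le> N" for i
    using suffix_domain_state_constraint[OF state_of_in_suffix_domain] D(1) that by blast
  then show ?thesis
    unfolding lift_trajectory_apply feasible_trajectories_def trajectories_def
    using D(3-5) by (auto simp: step_def intro: carrier_vecI)
qed

text \<open>States come first: S recovers z, and only for a common z does equality of controls yield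
  equality of v.\<close>

lemma inj_on_lift: "inj_on (lift_trajectory P \<rho>) (trajectories L)"
proof (rule inj_onI, clarify)
  fix z v z' v'
  assume zv: "(z, v) \<in> trajectories L" and zv': "(z', v') \<in> trajectories L"
    and eq: "lift_trajectory P \<rho> (z, v) = lift_trajectory P \<rho> (z', v')"
  note D = reduced_trajectoryD[OF zv] and D' = reduced_trajectoryD[OF zv']
  have z: "z i = z' i" if i: "i \<le> N" for i
  proof -
    have "state_of i (z i) = state_of i (z' i)"
      using eq i unfolding lift_trajectory_apply by (auto dest!: fun_cong[of _ _ i])
    then show ?thesis
      using state_of_inverse[OF i] D(1) D'(1) i by metis
  qed
  have v: "v i = v' i" if i: "i < N" for i
  proof -
    have "control_of i (z i) (v i) = control_of i (z i) (v' i)"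
      using eq i z[of i] unfolding lift_trajectory_apply by (auto dest!: fun_cong[of _ _ i])
    then show ?thesis
      using control_of_inject[OF i D(2) D'(2)] i by blast
  qed
  \<comment> \<open>Agreement on the index ranges suffices because trajectories are extensional
    functions.\<close>
  show "z = z' \<and> v = v'"
  proof
    show "z = z'"
      by (rule PiE_ext[of _ "{..N}" "\<lambda>i. carrier_vec (dim_col (parT \<rho> i))"])
        (use zv zv' z in \<open>auto simp: trajectories_reduced_iff\<close>)
    show "v = v'"
      by (rule PiE_ext[of _ "{..<N}" "\<lambda>i. carrier_vec (dim_col (parZ \<rho> i))"])
        (use zv zv' v in \<open>auto simp: trajectories_reduced_iff\<close>)
  qed
qed

lemma feasible_in_range_lift:
  assumes xu: "(x, u) \<in> feasible_trajectories P"
  shows "(x, u) \<in> lift_trajectory P \<rho> ` trajectories L"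
proof -
  \<comment> \<open>The only candidate preimage, by \<open>state_of_inverse\<close>; the restriction
    makes it extensional.\<close>
  define z where "z = (\<lambda>i\<in>{..N}. parS \<rho> i *\<^sub>v (x i - part \<rho> i))"
  have traj: "(x, u) \<in> trajectories P"
    and mixed: "\<And>i. i < N \<Longrightarrow> mixed_constraint P i (x i) (u i)"
    using xu by (auto simp: feasible_trajectories_def)
  have xs: "x i \<in> suffix_domain P i" if "i \<le> N" for i
    using feasible_in_suffix_domain[OF xu that] .
  have z: "z i \<in> carrier_vec (dim_col (parT \<rho> i))" "state_of i (z i) = x i" if "i \<le> N" for i
    using that suffix_domain_state_of[OF that xs[OF that]] by (auto simp: z_def intro: carrier_vecI)
  have u: "u i \<in> carrier_vec (udim P i)" and x_Suc: "x (Suc i) = step i (x i) (u i)" if "i < N" for i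
    using that traj by (auto simp: trajectories_def step_def)
  \<comment> \<open>The state x (i + 1) lies in its suffix domain by feasibility of the tail, so
    \<open>control_of_iff\<close> applies from left to right.\<close>
  have "\<exists>v\<in>carrier_vec (dim_col (parZ \<rho> i)). u i = control_of i (z i) v" if i: "i < N" for i
    using control_of_iff[OF i z(1) u[OF i]] z(2)[of i] mixed[OF i] x_Suc[OF i] xs[of "Suc i"] i
    by simp
  then obtain v where v: "\<And>i. i < N \<Longrightarrow>
      v i \<in> carrier_vec (dim_col (parZ \<rho> i)) \<and> u i = control_of i (z i) (v i)"
    by metis
  let ?v = "restrict v {..<N}"
  have "x 0 = init P"
    using traj by (simp add: trajectories_def)
  then have zv: "(z, ?v) \<in> trajectories L"
    unfolding trajectories_reduced_iff
    using z v x_Suc by (auto simp: z_def)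
  have "lift_trajectory P \<rho> (z, ?v) = (x, u)"
    unfolding lift_trajectory_apply using z v traj
    by (auto simp: trajectories_def PiE_iff extensional_def restrict_def fun_eq_iff)
  then show ?thesis
    using zv by (metis image_eqI)
qed

lemma bij_betw_lift: "bij_betw (lift_trajectory P \<rho>) (trajectories L) (feasible_trajectories P)"
  unfolding bij_betw_def
  using inj_on_lift lift_feasible feasible_in_range_lift by auto

section \<open>Objectives and minimizers\<close>

lemma objective_lift:
  assumes "\<tau> \<in> trajectories L"
  shows "objective P (lift_trajectory P \<rho> \<tau>) = objective L \<tau> + (\<Sum>i=0..N. kappa P \<rho> i)"
proof -
  obtain z v where \<tau>: "\<tau> = (z, v)" by fastforce
  note D = reduced_trajectoryD[OF assms[unfolded \<tau>]]
  have stage: "stage_cost P i (state_of i (z i)) (control_of i (z i) (v i))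
      = stage_cost L i (z i) (v i) + kappa P \<rho> i" if "i < N" for i
    using reduced_stage_cost[OF that] D(1,2) that by simp
  \<comment> \<open>Splits off the terminal constant, which belongs to the terminal cost; the other
    constants pair with the stage costs.\<close>
  have "{0..N} = insert N {..<N}"
    by auto
  moreover have "horizon L = N"
    by (simp add: reduced_lqr_def)
  ultimately show ?thesis
    using reduced_terminal_cost[of "z N"] D(1)[of N]
    by (simp add: \<tau> objective_def lift_trajectory_apply stage sum.distrib)
qed

end

text \<open>A constant shift preserves strict comparisons, and surjectivity of g turns every
  competitor in B into one in A.\<close>

lemma is_arg_min_bij_betw:
  fixes c :: "'c :: linordered_ab_group_add"
  assumes "bij_betw g A B" and "\<And>x. x \<in> A \<Longrightarrow> f' (g x) = f x + c" and "x \<in> A"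
  shows "is_arg_min f (\<lambda>y. y \<in> A) x \<longleftrightarrow> is_arg_min f' (\<lambda>y. y \<in> B) (g x)"
  using assms unfolding is_arg_min_def bij_betw_def by force

theorem theorem5:
  fixes P :: eq_lqr and \<rho> :: reduction
  assumes "wf_eq_lqr P"
    and "represents_suffix_domains P \<rho>"
    and "domH \<rho> 0 *\<^sub>v init P + domh \<rho> 0 = 0\<^sub>v (dim_row (domH \<rho> 0))"
    and "parametrizes_states P \<rho>"
    and "parametrizes_controls P \<rho>"
  shows "bij_betw (lift_trajectory P \<rho>)
           (trajectories (reduced_lqr P \<rho>)) (feasible_trajectories P)
         \<and> (\<forall>\<tau>\<in>trajectories (reduced_lqr P \<rho>).
              objective P (lift_trajectory P \<rho> \<tau>)
                = objective (reduced_lqr P \<rho>) \<tau> + (\<Sum>i=0..horizon P. kappa P \<rho> i))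
         \<and> (\<forall>\<tau>\<in>trajectories (reduced_lqr P \<rho>).
              minimizer (reduced_lqr P \<rho>) (trajectories (reduced_lqr P \<rho>)) \<tau>
                \<longleftrightarrow> minimizer P (feasible_trajectories P) (lift_trajectory P \<rho> \<tau>))"
proof -
  interpret lqr_reduction P \<rho>
    using assms by unfold_locales
  have "minimizer L (trajectories L) \<tau>
      \<longleftrightarrow> minimizer P (feasible_trajectories P) (lift_trajectory P \<rho> \<tau>)"
    if "\<tau> \<in> trajectories L" for \<tau>
    unfolding minimizer_def
    by (rule is_arg_min_bij_betw[where c = "\<Sum>i=0..N. kappa P \<rho> i"])
      (use bij_betw_lift objective_lift that in auto)
  then show ?thesis
    using bij_betw_lift objective_lift by blast
qed

end
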